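(* Let $\Omega=\{\rho_k\}$ be a finite nonempty set of qubit states (density matrices on $\mathbb{C}^2$), and let $A_i=\vec a_i\cdot\vec\sigma$ and $A_j=\vec a_j\cdot\vec\sigma$ be two binary qubit projective measurements, where $\vec a_i,\vec a_j\in\mathbb{R}^3$ are unit vectors and $\vec\sigma=(\sigma_x,\sigma_y,\sigma_z)$ is the vector of Pauli matrices. Put $A_{l|\rho_k}:=\operatorname{Tr}(\rho_k A_l)$ for $l\in\{i,j\}$ and $\rho_k\in\Omega$. Then $$\max_{\rho_k\in\Omega} g_-(A_{i|\rho_k},A_{j|\rho_k})\ \le\ \min_{\rho_k\in\Omega} g_+(A_{i|\rho_k},A_{j|\rho_k}),$$ where, for $u,v\in[-1,1]$, $$g_\pm(u,v):=uv\pm\sqrt{1-u^2}\,\sqrt{1-v^2}.$$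
   Context: Prepare-and-measure scenario without public randomness (independent devices): a source prepares a qubit state $\rho_k$ from a fixed set $\Omega$, and a measurement device performs one of a fixed set of measurements; there is no run-to-run mixing, so the observed expectation values are exactly $A_{l|\rho_k}=\operatorname{Tr}(\rho_k A_l)$ for one fixed choice of states and measurements, with each measurement operator the same for all $\rho_k\in\Omega$. A binary measurement is represented by its observable $A_l$, with the two outcomes described by the operators $(\mathbb{I}\pm A_l)/2$. Binary qubit projective measurements (PVMs) are those of the form $A_l=\vec a_l\cdot\vec\sigma$ with $|\vec a_l|=1$. *)

theory Defs
  imports "HOL-Analysis.Analysis"
begin

definition sigma_x :: "complex^2^2" where
  "sigma_x = vector [vector [0, 1], vector [1, 0]]"

definition sigma_y :: "complex^2^2" where
  "sigma_y = vector [vector [0, -\<i>], vector [\<i>, 0]]"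

definition sigma_z :: "complex^2^2" where
  "sigma_z = vector [vector [1, 0], vector [0, -1]]"

definition pauli_observable :: "real^3 \<Rightarrow> complex^2^2" where
  "pauli_observable a = a$1 *\<^sub>R sigma_x + a$2 *\<^sub>R sigma_y + a$3 *\<^sub>R sigma_z"

definition hermitian :: "complex^'n^'n \<Rightarrow> bool" where
  "hermitian M \<longleftrightarrow> (\<forall>i j. M$i$j = cnj (M$j$i))"

(* The library inner product on complex^'n is the real one, so the sesquilinear form
   v^* M v is written out. It is real for Hermitian M, hence taking Re loses nothing. *)
definition positive_semidefinite :: "complex^'n^'n \<Rightarrow> bool" where
  "positive_semidefinite M \<longleftrightarrow>
     hermitian M \<and> (\<forall>v. 0 \<le> Re (\<Sum>i\<in>UNIV. cnj (v$i) * (M *v v)$i))"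

definition density_matrix :: "complex^'n^'n \<Rightarrow> bool" where
  "density_matrix \<rho> \<longleftrightarrow> positive_semidefinite \<rho> \<and> trace \<rho> = 1"

(* Tr(rho A), which is a real number for Hermitian arguments: see of_real_expectation. *)
definition expectation :: "complex^'n^'n \<Rightarrow> complex^'n^'n \<Rightarrow> real" where
  "expectation A \<rho> = Re (trace (\<rho> ** A))"

lemma of_real_expectation:
  assumes "hermitian \<rho>" "hermitian A"
  shows "complex_of_real (expectation A \<rho>) = trace (\<rho> ** A)"
proof -
  have "cnj (trace (\<rho> ** A)) = (\<Sum>i\<in>UNIV. \<Sum>j\<in>UNIV. cnj (\<rho>$i$j) * cnj (A$j$i))"
    by (simp add: trace_def matrix_matrix_mult_def)
  also have "\<dots> = (\<Sum>i\<in>UNIV. \<Sum>j\<in>UNIV. \<rho>$j$i * A$i$j)"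
  proof (intro sum.cong refl)
    fix i j
    have "cnj (\<rho>$i$j) = \<rho>$j$i" "cnj (A$j$i) = A$i$j"
      using assms unfolding hermitian_def by metis+
    then show "cnj (\<rho>$i$j) * cnj (A$j$i) = \<rho>$j$i * A$i$j" by simp
  qed
  also have "\<dots> = (\<Sum>j\<in>UNIV. \<Sum>i\<in>UNIV. \<rho>$j$i * A$i$j)"
    by (rule sum.swap)
  also have "\<dots> = trace (\<rho> ** A)"
    by (simp add: trace_def matrix_matrix_mult_def)
  finally have "trace (\<rho> ** A) \<in> \<real>"
    by (simp add: Reals_cnj_iff)
  then show ?thesis
    unfolding expectation_def by (rule of_real_Re)
qed

lemma hermitian_pauli_observable: "hermitian (pauli_observable a)"
  by (simp add: hermitian_def pauli_observable_def sigma_x_def sigma_y_def sigma_z_def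
      forall_2 complex_eq_iff)

(* Meant for u, v in [-1, 1], which is where expectation values of projective binary
   observables in density matrices lie. *)
definition g_plus :: "real \<Rightarrow> real \<Rightarrow> real" where
  "g_plus u v = u * v + sqrt (1 - u\<^sup>2) * sqrt (1 - v\<^sup>2)"

definition g_minus :: "real \<Rightarrow> real \<Rightarrow> real" where
  "g_minus u v = u * v - sqrt (1 - u\<^sup>2) * sqrt (1 - v\<^sup>2)"

end

theory Submission
  imports Defs
begin

text \<open>
  Let \<open>r\<close> be the Bloch vector of a state, so that the expectation values are \<open>u = r \<bullet> a\<^sub>i\<close> and
  \<open>v = r \<bullet> a\<^sub>j\<close> with \<open>norm r \<le> 1\<close>. Positivity of the Gram matrix then gives
  \<open>(a\<^sub>i \<bullet> a\<^sub>j - u v)\<^sup>2 \<le> (1 - u\<^sup>2) (1 - v\<^sup>2)\<close>, so the number \<open>a\<^sub>i \<bullet> a\<^sub>j\<close>, which does not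
  depend on the state, separates all values of \<open>g_minus\<close> from all values of \<open>g_plus\<close>.
\<close>

lemma abs_inner_minus_prod_le:
  fixes a b r :: "'a::real_inner"
  assumes a: "norm a = 1" and b: "norm b = 1" and r: "norm r \<le> 1"
  shows "\<bar>a \<bullet> b - (r \<bullet> a) * (r \<bullet> b)\<bar> \<le> sqrt (1 - (r \<bullet> a)\<^sup>2) * sqrt (1 - (r \<bullet> b)\<^sup>2)"
proof -
  \<comment> \<open>Adding one dimension completes \<open>r\<close> to a unit vector without changing its inner products
      with \<open>a\<close> and \<open>b\<close>; the claim is Cauchy-Schwarz for the components orthogonal to it.\<close>
  define R where "R = (r, sqrt (1 - r \<bullet> r))"
  define P where "P x = (x, 0) - (r \<bullet> x) *\<^sub>R R" for x
  have "(norm r)\<^sup>2 \<le> 1"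
    using r by (simp add: abs_square_le_1)
  then have "r \<bullet> r \<le> 1"
    by (simp add: power2_norm_eq_inner)
  then have R: "R \<bullet> R = 1"
    by (simp add: R_def)
  have P: "P x \<bullet> P y = x \<bullet> y - (r \<bullet> x) * (r \<bullet> y)" for x y
  proof -
    have "(z, 0) \<bullet> R = r \<bullet> z" "R \<bullet> (z, 0) = r \<bullet> z" for z
      by (simp_all add: R_def inner_commute)
    then show ?thesis
      by (simp add: P_def inner_diff_left inner_diff_right R)
  qed
  have "a \<bullet> a = 1" "b \<bullet> b = 1"
    using a b by (simp_all add: norm_eq_1)
  then show ?thesis
    using Cauchy_Schwarz_ineq2[of "P a" "P b"]
    by (simp add: norm_eq_sqrt_inner P power2_eq_square)
qed

text \<open>The \<open>r\<close> with \<open>\<rho> = (I + r \<bullet> \<sigma>) / 2\<close> for a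
  density matrix; there \<open>\<rho>$1$2 = (r$1 - \<i> * r$2) / 2\<close>, whence the minus
  sign.\<close>

definition bloch_vector :: "complex^2^2 \<Rightarrow> real^3" where
  "bloch_vector \<rho> = vector [2 * Re (\<rho>$1$2), - 2 * Im (\<rho>$1$2), Re (\<rho>$1$1) - Re (\<rho>$2$2)]"

lemma expectation_pauli_observable:
  assumes "hermitian \<rho>"
  shows "expectation (pauli_observable a) \<rho> = bloch_vector \<rho> \<bullet> a"
proof -
  have "\<rho>$2$1 = cnj (\<rho>$1$2)"
    using assms unfolding hermitian_def by blast
  then show ?thesis
    by (simp add: expectation_def pauli_observable_def sigma_x_def sigma_y_def sigma_z_def
        bloch_vector_def trace_def matrix_matrix_mult_def sum_2 inner_vec_def sum_3 algebra_simps)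
qed

text \<open>At trace 1, one minus the squared norm is four times the determinant, which positivity
  makes nonnegative.\<close>

lemma norm_bloch_vector_le_1:
  assumes "density_matrix \<rho>"
  shows "norm (bloch_vector \<rho>) \<le> 1"
proof -
  define p q x y where "p = Re (\<rho>$1$1)" and "q = Re (\<rho>$2$2)"
    and "x = Re (\<rho>$1$2)" and "y = Im (\<rho>$1$2)"
  have psd: "0 \<le> Re (\<Sum>i\<in>UNIV. cnj (v$i) * (\<rho> *v v)$i)" for v
    using assms by (simp add: density_matrix_def positive_semidefinite_def)
  have herm: "\<rho>$i$j = cnj (\<rho>$j$i)" for i j
    using assms unfolding density_matrix_def positive_semidefinite_def hermitian_def by blast
  have "Im (\<rho>$1$1) = 0" "Im (\<rho>$2$2) = 0"
    using arg_cong[OF herm[of 1 1], of Im] arg_cong[OF herm[of 2 2], of Im] by simp_all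
  then have entries: "\<rho>$1$1 = of_real p" "\<rho>$2$2 = of_real q"
      "\<rho>$1$2 = Complex x y" "\<rho>$2$1 = Complex x (- y)"
    by (simp_all add: complex_eq_iff p_def q_def x_def y_def herm[of 2 1])
  have pq: "p + q = 1"
    using assms by (simp add: density_matrix_def trace_def sum_2 entries complex_eq_iff)
  \<comment> \<open>The test vectors are the columns of the adjugate of \<open>\<rho>\<close>, so \<open>\<rho>\<close> maps them to multiples
      of the standard basis vectors by its determinant.\<close>
  have "0 \<le> p * (p * q - x\<^sup>2 - y\<^sup>2)"
    using psd[of "vector [- Complex x y, of_real p]"]
    by (simp add: sum_2 matrix_vector_mult_def entries power2_eq_square algebra_simps)
  moreover have "0 \<le> q * (p * q - x\<^sup>2 - y\<^sup>2)"
    using psd[of "vector [of_real q, - Complex x (- y)]"]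
    by (simp add: sum_2 matrix_vector_mult_def entries power2_eq_square algebra_simps)
  \<comment> \<open>Either of \<open>p\<close> and \<open>q\<close> may vanish, but their sum is the
    trace 1, so adding avoids a case split.\<close>
  ultimately have "0 \<le> (p + q) * (p * q - x\<^sup>2 - y\<^sup>2)"
    by (simp only: distrib_right add_nonneg_nonneg)
  then have det: "0 \<le> p * q - x\<^sup>2 - y\<^sup>2"
    by (simp add: pq)
  have "(norm (bloch_vector \<rho>))\<^sup>2 = 4 * x\<^sup>2 + 4 * y\<^sup>2 + (p - q)\<^sup>2"
    unfolding power2_norm_eq_inner
    by (simp add: bloch_vector_def inner_vec_def sum_3 p_def q_def x_def y_def power2_eq_square)
  also have "\<dots> = (p + q)\<^sup>2 - 4 * (p * q - x\<^sup>2 - y\<^sup>2)"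
    by (simp add: power2_eq_square algebra_simps)
  also have "\<dots> \<le> 1"
    using det by (simp add: pq)
  finally show ?thesis
    by (simp add: abs_square_le_1)
qed

theorem theorem1:
  fixes \<Omega> :: "(complex^2^2) set"
    and a\<^sub>i a\<^sub>j :: "real^3"
    and A\<^sub>i A\<^sub>j :: "complex^2^2"
  assumes "finite \<Omega>" and "\<Omega> \<noteq> {}"
    and "\<And>\<rho>. \<rho> \<in> \<Omega> \<Longrightarrow> density_matrix \<rho>"
    and "norm a\<^sub>i = 1" and "norm a\<^sub>j = 1"
    and "A\<^sub>i = pauli_observable a\<^sub>i" and "A\<^sub>j = pauli_observable a\<^sub>j"
  shows "(MAX \<rho>\<in>\<Omega>. g_minus (expectation A\<^sub>i \<rho>) (expectation A\<^sub>j \<rho>))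
       \<le> (MIN \<rho>\<in>\<Omega>. g_plus (expectation A\<^sub>i \<rho>) (expectation A\<^sub>j \<rho>))"
proof -
  have "g_minus (expectation A\<^sub>i \<rho>) (expectation A\<^sub>j \<rho>) \<le> a\<^sub>i \<bullet> a\<^sub>j \<and>
      a\<^sub>i \<bullet> a\<^sub>j \<le> g_plus (expectation A\<^sub>i \<rho>) (expectation A\<^sub>j \<rho>)" if "\<rho> \<in> \<Omega>" for \<rho>
  proof -
    have \<rho>: "density_matrix \<rho>"
      using assms(3) that .
    then have "hermitian \<rho>"
      by (simp add: density_matrix_def positive_semidefinite_def)
    then show ?thesis
      using abs_inner_minus_prod_le[OF assms(4,5) norm_bloch_vector_le_1[OF \<rho>]]
      by (simp add: assms(6,7) expectation_pauli_observable g_minus_def g_plus_def abs_le_iff)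
  qed
  then have "(MAX \<rho>\<in>\<Omega>. g_minus (expectation A\<^sub>i \<rho>) (expectation A\<^sub>j \<rho>)) \<le> a\<^sub>i \<bullet> a\<^sub>j"
    and "a\<^sub>i \<bullet> a\<^sub>j \<le> (MIN \<rho>\<in>\<Omega>. g_plus (expectation A\<^sub>i \<rho>) (expectation A\<^sub>j \<rho>))"
    using assms(1,2) by (auto intro!: Max.boundedI Min.boundedI)
  then show ?thesis
    by (rule order_trans)
qed

end
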